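(* Let $d=2$ and let $E\subset(0,\infty)$ satisfy $$\sup_{k>0}\ \sup_{0<\delta<1/10}N(E^k,2^k\delta)\,\delta\,\log\delta^{-1}=\infty ,$$ where $k$ ranges over positive integers. Then $\mathcal M_E$ is not of restricted weak type $(2,2)$, i.e. it does not map the Lorentz space $L^{2,1}(\mathbb R^2)$ boundedly to $L^{2,\infty}(\mathbb R^2)$.
   Context: $d\sigma$ is the rotationally invariant measure on the unit circle $S^1$ with total mass $1$; $\mathcal A_tf(x)=\int_{S^1}f(x-ty)\,d\sigma(y)$ for $x\in\mathbb R^2$; $\mathcal M_Ef(x)=\sup_{t\in E}|\mathcal A_tf(x)|$. $N(E,\delta)$ is the minimal number of intervals of length $\delta$ needed to cover $E$, with the convention $N(\emptyset,\delta)=1$. $E^k=[2^k,2^{k+1})\cap E$. *)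

theory Defs
  imports "HOL-Analysis.Analysis"
begin

text \<open>Rotationally invariant probability measure on the unit circle, as a Borel measure on the plane.\<close>

definition circle_measure :: "(real^2) measure" where
  "circle_measure =
     distr (uniform_measure lborel {0..<2 * pi}) borel (\<lambda>\<theta>. vector [cos \<theta>, sin \<theta>])"

text \<open>The Bochner integral is \<open>0\<close> when \<open>f\<close> is not integrable along the circle in question; this can
  only decrease the maximal function below.\<close>

definition circular_mean :: "real \<Rightarrow> (real^2 \<Rightarrow> complex) \<Rightarrow> real^2 \<Rightarrow> complex" where
  "circular_mean t f x = (LINT y|circle_measure. f (x - t *\<^sub>R y))"

definition maximal_fn :: "real set \<Rightarrow> (real^2 \<Rightarrow> complex) \<Rightarrow> real^2 \<Rightarrow> ennreal" where
  "maximal_fn E f x = (SUP t\<in>E. ennreal (cmod (circular_mean t f x)))"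

text \<open>Closed intervals of length \<open>\<delta>\<close>: every interval of length \<open>\<delta>\<close> lies in a closed one, so allowing
  other kinds of intervals does not change the minimum. The value is \<open>\<infinity>\<close> if no finite cover exists.\<close>

definition covering_number :: "real set \<Rightarrow> real \<Rightarrow> enat" where
  "covering_number E \<delta> =
     (if E = {} then 1
      else (INF C\<in>{C. finite C \<and> E \<subseteq> (\<Union>c\<in>C. {c..c + \<delta>})}. enat (card C)))"

definition dyadic_part :: "real set \<Rightarrow> nat \<Rightarrow> real set" where
  "dyadic_part E k = {2 ^ k..<2 ^ (k + 1)} \<inter> E"

text \<open>The outer measure agrees with the measure on measurable sets. It is used because the maximal
  function, a supremum over a possibly uncountable and nonmeasurable set of radii, need not be
  measurable, and \<^const>\<open>emeasure\<close> is \<open>0\<close> on nonmeasurable sets.\<close>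

definition distribution_fn :: "'a measure \<Rightarrow> ('a \<Rightarrow> ennreal) \<Rightarrow> ennreal \<Rightarrow> ennreal" where
  "distribution_fn M g s = outer_measure_of M {x \<in> space M. s < g x}"

definition decreasing_rearrangement :: "'a measure \<Rightarrow> ('a \<Rightarrow> ennreal) \<Rightarrow> real \<Rightarrow> ennreal" where
  "decreasing_rearrangement M g t = Inf {s. distribution_fn M g s \<le> ennreal t}"

text \<open>The Lorentz quasinorms
  \<open>\<parallel>g\<parallel>\<^bsub>p,1\<^esub> = \<integral> t\<^bsup>1/p\<^esup> g*(t) dt/t\<close> over \<open>t > 0\<close> and
  \<open>\<parallel>g\<parallel>\<^bsub>p,\<infinity>\<^esub> = sup t\<^bsup>1/p\<^esup> g*(t)\<close> over \<open>t > 0\<close>,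
  where \<open>g*\<close> is the decreasing rearrangement.\<close>

definition lorentz_1 :: "real \<Rightarrow> 'a measure \<Rightarrow> ('a \<Rightarrow> ennreal) \<Rightarrow> ennreal" where
  "lorentz_1 p M g =
     (\<integral>\<^sup>+t\<in>{0<..}. ennreal (t powr (1 / p)) * decreasing_rearrangement M g t * ennreal (1 / t) \<partial>lborel)"

definition lorentz_inf :: "real \<Rightarrow> 'a measure \<Rightarrow> ('a \<Rightarrow> ennreal) \<Rightarrow> ennreal" where
  "lorentz_inf p M g =
     (SUP t\<in>{0<..}. ennreal (t powr (1 / p)) * decreasing_rearrangement M g t)"

text \<open>Elements of \<open>L\<^bsup>p,1\<^esup>\<close> are represented by Borel functions.\<close>

definition lorentz_space_1 :: "real \<Rightarrow> (real^2 \<Rightarrow> complex) set" where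
  "lorentz_space_1 p =
     {f \<in> borel_measurable borel. lorentz_1 p lborel (\<lambda>x. ennreal (cmod (f x))) < \<infinity>}"

definition restricted_weak_type ::
    "real \<Rightarrow> real \<Rightarrow> ((real^2 \<Rightarrow> complex) \<Rightarrow> real^2 \<Rightarrow> ennreal) \<Rightarrow> bool" where
  "restricted_weak_type p q T \<longleftrightarrow>
     (\<exists>C::real. \<forall>f\<in>lorentz_space_1 p.
        lorentz_inf q lborel (T f) \<le> ennreal C * lorentz_1 p lborel (\<lambda>x. ennreal (cmod (f x))))"

end

theory Submission
  imports Defs "HOL-Library.Nat_Bijection"
begin

text \<open>
  A tube of length \<open>h\<close> and width of order \<open>h\<^sup>2\<close> contains an arc of length of order \<open>h\<close> of
  every circle of radius in \<open>[1, 2)\<close> that is nearly tangent to it. The \<open>2\<^sup>n\<close> tubes of a Kakeya set,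
  with \<open>2\<^sup>n\<close> of order \<open>1 / h\<close>, have a union of area only of order \<open>h\<^sup>2 / n\<close>. The centres of the
  circles tangent to different tubes lie in different angular sectors, because all tubes lie within
  distance of order \<open>h\<close> of the origin while the radii are at least \<open>1\<close>. If the radii meet \<open>N\<close>
  intervals of length \<open>h\<^sup>2\<close>, the centres therefore fill an area of order \<open>N h\<^sup>2\<close>, on which the maximal
  function of the indicator of the Kakeya set is at least of order \<open>h\<close>. The weak type inequality forces
  \<open>h\<^sup>2 \<cdot> N h\<^sup>2\<close> to be at most of order \<open>h\<^sup>2 / n\<close>, so \<open>N h\<^sup>2 n\<close> is bounded; with \<open>\<delta>\<close> comparable to \<open>h\<^sup>2\<close>
  this bounds \<open>N \<delta> log (1 / \<delta>)\<close>. Dilation reduces radii in \<open>[2\<^sup>k, 2\<^sup>k\<^sup>+\<^sup>1)\<close> to radii in \<open>[1, 2)\<close>.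
\<close>

subsection \<open>Parallelograms\<close>

lemma borel_measurable_component [measurable]: "(\<lambda>z::real^2. z $ i) \<in> borel_measurable borel"
  by (intro borel_measurable_continuous_onI continuous_intros)

text \<open>Half-open in the vertical direction, so that the pieces belonging to consecutive grid
  radii can touch without overlapping.\<close>

definition parallelogram :: "real \<Rightarrow> real \<Rightarrow> real \<Rightarrow> real \<Rightarrow> real \<Rightarrow> (real^2) set" where
  "parallelogram a l r p q =
     {z. l \<le> z$1 \<and> z$1 \<le> r \<and> p \<le> z$2 - a * z$1 \<and> z$2 - a * z$1 < q}"

lemma parallelogram_borel [measurable]: "parallelogram a l r p q \<in> sets borel"
  unfolding parallelogram_def by measurable

lemma shear_image:
  fixes S :: "(real^2) set" and a :: real
  assumes "S \<in> lmeasurable"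
  defines "f \<equiv> \<lambda>x::real^2. (\<chi> i. if i = 2 then x$2 + a * x$1 else x$i) :: real^2"
  shows "f ` S \<in> lmeasurable" "emeasure lebesgue (f ` S) = emeasure lebesgue S"
proof -
  have lin: "linear f"
    unfolding f_def by (rule linearI) (auto simp: vec_eq_iff algebra_simps)
  show meas: "f ` S \<in> lmeasurable"
    using lin assms(1) by (rule measurable_linear_image)
  have "det (matrix f) = 1"
    by (simp add: det_2 matrix_def axis_def f_def)
  then have "measure lebesgue (f ` S) = measure lebesgue S"
    using measure_linear_image[OF lin assms(1)] by simp
  then show "emeasure lebesgue (f ` S) = emeasure lebesgue S"
    using assms(1) meas by (simp add: emeasure_eq_measure2)
qed

text \<open>The set lies between the sheared open box and the sheared closed box, which have the
  same area because a shear has determinant 1.\<close>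

lemma emeasure_parallelogram:
  assumes "l \<le> r" "p \<le> q"
  shows "emeasure lborel (parallelogram a l r p q) = ennreal ((r - l) * (q - p))"
proof -
  define f :: "real^2 \<Rightarrow> real^2" where "f = (\<lambda>x. \<chi> i. if i = 2 then x$2 + a * x$1 else x$i)"
  define u :: "real^2" where "u = vector [l, p]"
  define v :: "real^2" where "v = vector [r, q]"
  have "u \<bullet> b \<le> v \<bullet> b" if "b \<in> Basis" for b
  proof -
    have "u $ i \<le> v $ i" for i
      using assms exhaust_2[of i] by (auto simp: u_def v_def)
    then show ?thesis
      using that by (auto simp: Basis_vec_def inner_axis)
  qed
  moreover have "(\<Prod>b\<in>Basis. (v - u) \<bullet> b) = (r - l) * (q - p)"
  proof -
    have "(\<Prod>b\<in>Basis. (v - u) \<bullet> b) = (\<Prod>i\<in>UNIV. (v - u) $ i)"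
      by (simp add: Basis_vec_def cart_eq_inner_axis axis_eq_axis prod.UNION_disjoint)
    then show ?thesis
      unfolding UNIV_2 by (simp add: u_def v_def)
  qed
  ultimately have "emeasure lebesgue (box u v) = ennreal ((r - l) * (q - p))"
    "emeasure lebesgue (cbox u v) = ennreal ((r - l) * (q - p))"
    by (auto simp: emeasure_lborel_box_eq emeasure_lborel_cbox_eq)
  then have 1: "emeasure lebesgue (f ` box u v) = ennreal ((r - l) * (q - p))"
    and 2: "emeasure lebesgue (f ` cbox u v) = ennreal ((r - l) * (q - p))"
    by (simp_all add: f_def shear_image)
  have "f ` box u v \<subseteq> parallelogram a l r p q"
    by (auto simp: f_def parallelogram_def u_def v_def mem_box_cart forall_2)
  moreover have "parallelogram a l r p q \<subseteq> f ` cbox u v"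
  proof
    fix x assume "x \<in> parallelogram a l r p q"
    then show "x \<in> f ` cbox u v"
      by (intro image_eqI[of _ _ "vector [x$1, x$2 - a * x$1]"])
        (auto simp: f_def vec_eq_iff forall_2 parallelogram_def u_def v_def mem_box_cart)
  qed
  moreover have "f ` cbox u v \<in> sets lebesgue"
    unfolding f_def by (intro fmeasurableD shear_image) simp
  ultimately have "emeasure lebesgue (parallelogram a l r p q) = ennreal ((r - l) * (q - p))"
    using 1 2 emeasure_mono[of "f ` box u v" "parallelogram a l r p q" lebesgue]
       emeasure_mono[of "parallelogram a l r p q" "f ` cbox u v" lebesgue] by (auto intro!: antisym)
  then show ?thesis
    by simp
qed

subsection \<open>A Kakeya set of dyadic tubes\<close>

text \<open>A set \<open>S\<close> of binary digits encodes the line \<open>y = slope n S * x + offset n S\<close>. The digit of weight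
  \<open>2 ^ i / 2 ^ n\<close> contributes a multiple of \<open>x - (n - 1 - i) / n\<close>, so that for \<open>x\<close> between \<open>k / n\<close> and
  \<open>(k + 1) / n\<close> the lines sharing the \<open>k\<close> leading digits are within \<open>4 / (2 ^ k * n)\<close> of each other.\<close>

definition slope :: "nat \<Rightarrow> nat set \<Rightarrow> real" where
  "slope n S = (\<Sum>i\<in>S. 2 ^ i / 2 ^ n)"

definition offset :: "nat \<Rightarrow> nat set \<Rightarrow> real" where
  "offset n S = - (\<Sum>i\<in>S. 2 ^ i / 2 ^ n * ((real n - 1 - real i) / real n))"

lemma slope_eq_set_encode: "slope n S = real (set_encode S) / 2 ^ n"
  by (simp add: slope_def set_encode_def sum_divide_distrib)

lemma slope_nonneg: "0 \<le> slope n S"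
  by (simp add: slope_def sum_nonneg)

lemma slope_le_1:
  assumes "S \<subseteq> {..<n}"
  shows "slope n S \<le> 1"
proof -
  have "slope n S \<le> slope n {..<n}"
    unfolding slope_def using assms by (intro sum_mono2) auto
  also have "\<dots> = (\<Sum>i<n. 2 ^ i) / 2 ^ n"
    by (simp add: slope_def sum_divide_distrib)
  also have "\<dots> = (2 ^ n - 1) / 2 ^ n"
    by (simp add: geometric_sum)
  also have "\<dots> \<le> 1"
    by (simp add: field_simps)
  finally show ?thesis .
qed

text \<open>The offset is minus the slope sum with extra weights \<open>(n - 1 - i) / n\<close> in
  [0, 1], so it lies between \<open>- slope n S\<close> and 0.\<close>

lemma offset_bounds:
  assumes "S \<subseteq> {..<n}"
  shows "-1 \<le> offset n S" "offset n S \<le> 0"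
proof -
  have "(\<Sum>i\<in>S. 2 ^ i / 2 ^ n * ((real n - 1 - real i) / real n)) \<le> slope n S"
    unfolding slope_def using assms by (intro sum_mono mult_left_le) (auto simp: divide_simps)
  then show "-1 \<le> offset n S"
    using slope_le_1[OF assms] by (simp add: offset_def)
  have "0 \<le> (\<Sum>i\<in>S. 2 ^ i / 2 ^ n * ((real n - 1 - real i) / real n))"
  proof (intro sum_nonneg mult_nonneg_nonneg divide_nonneg_nonneg)
    fix i assume "i \<in> S"
    then have "i < n"
      using assms by auto
    then show "0 \<le> real n - 1 - real i"
      by linarith
  qed auto
  then show "offset n S \<le> 0"
    by (simp add: offset_def)
qed

text \<open>\<open>2 ^ n\<close> times the slope is the binary code of the digit set, and distinct
  codes are integers at least 1 apart.\<close>

lemma slope_separated: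
  assumes "S \<subseteq> {..<n}" "S' \<subseteq> {..<n}" "S \<noteq> S'"
  shows "1 / 2 ^ n \<le> \<bar>slope n S - slope n S'\<bar>"
proof -
  have "set_encode S \<noteq> set_encode S'"
    using assms by (meson finite_lessThan finite_subset set_encode_eq)
  then have "1 \<le> \<bar>real (set_encode S) - real (set_encode S')\<bar>"
    by linarith
  moreover have "\<bar>slope n S - slope n S'\<bar> = \<bar>real (set_encode S) - real (set_encode S')\<bar> / 2 ^ n"
    unfolding slope_eq_set_encode by (simp add: abs_divide flip: diff_divide_distrib)
  ultimately show ?thesis
    by (simp add: divide_right_mono)
qed

text \<open>A figure of unit size dilated by \<open>h\<close>: intercepts scale, slopes do not. The
  width \<open>w\<close> stays free, as it will be of order \<open>h^2\<close>.\<close>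

definition kakeya_set :: "nat \<Rightarrow> real \<Rightarrow> real \<Rightarrow> (real^2) set" where
  "kakeya_set n h w =
     (\<Union>S\<in>Pow {..<n}. parallelogram (slope n S) 0 h (h * offset n S) (h * offset n S + w))"

lemma kakeya_set_borel [measurable]: "kakeya_set n h w \<in> sets borel"
  unfolding kakeya_set_def by (intro sets.finite_UN) auto

section \<open>Area of the Kakeya set\<close>

lemma sum_power2_mult_diff: "(\<Sum>i<L. 2 ^ i * (real L - real i)) \<le> 2 * 2 ^ L"
proof -
  have "(\<Sum>i<L. 2 ^ i * (real L - real i)) = 2 * 2 ^ L - real L - 2"
  proof (induction L)
    case (Suc L)
    \<comment> \<open>At \<open>i = L\<close> the term \<open>2 ^ i * (real L - real i)\<close>
      vanishes, so what remains is the induction hypothesis plus a geometric sum.\<close>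
    have "2 ^ i * (real (Suc L) - real i) = 2 ^ i * (real L - real i) + 2 ^ i" for i
      by (simp add: algebra_simps)
    then have "(\<Sum>i<Suc L. 2 ^ i * (real (Suc L) - real i))
      = (\<Sum>i<L. 2 ^ i * (real L - real i)) + (\<Sum>i<Suc L. 2 ^ i)"
      by (simp only: sum.distrib) simp
    then show ?case
      by (simp add: Suc geometric_sum)
  qed simp
  then show ?thesis by simp
qed

text \<open>A discarded digit \<open>i < n - k\<close> contributes \<open>2 ^ i / 2 ^ n\<close>
  times the distance from \<open>x\<close> to the pivot \<open>h * (n - 1 - i) / n\<close>, and that
  distance is at most \<open>h * (n - k - i) / n\<close> throughout the strip.\<close>

lemma digit_truncation:
  assumes S: "S \<subseteq> {..<n}" and k: "k < n" and h: "0 \<le> h"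
    and x: "h * real k / real n \<le> x" "x \<le> h * (real k + 1) / real n"
  defines "P \<equiv> S \<inter> {n - k..<n}"
  shows "\<bar>(slope n S * x + h * offset n S) - (slope n P * x + h * offset n P)\<bar> \<le> 2 * h / (2 ^ k * n)"
proof -
  define g where "g i = 2 ^ i / 2 ^ n * (x - h * (real n - 1 - real i) / real n)" for i
  have line: "slope n A * x + h * offset n A = sum g A" for A
    by (simp add: slope_def offset_def g_def sum_distrib_left sum_distrib_right sum_subtractf
          algebra_simps)
  have "finite S"
    using S finite_subset by auto
  then have "sum g S = sum g P + sum g (S \<inter> {..<n - k})"
    using S by (subst sum.union_disjoint[symmetric]) (auto simp: P_def intro!: sum.cong)
  then have "\<bar>(slope n S * x + h * offset n S) - (slope n P * x + h * offset n P)\<bar>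
      = \<bar>sum g (S \<inter> {..<n - k})\<bar>"
    by (simp add: line)
  also have "\<dots> \<le> (\<Sum>i\<in>S \<inter> {..<n - k}. \<bar>g i\<bar>)"
    by (rule sum_abs)
  also have "\<dots> \<le> (\<Sum>i<n - k. \<bar>g i\<bar>)"
    by (intro sum_mono2) auto
  also have "\<dots> \<le> (\<Sum>i<n - k. h / (2 ^ n * n) * (2 ^ i * (real (n - k) - real i)))"
  proof (intro sum_mono)
    fix i assume "i \<in> {..<n - k}"
    then have i: "real i + 1 \<le> real n - real k"
      by (simp add: less_diff_conv)
    have n: "real n > 0"
      using k by simp
    have "x * n - h * (real n - 1 - real i) \<le> h * (real n - real k - real i)"
    proof -
      have "x * n \<le> h * (real k + 1)"
        using x(2) n by (simp add: field_simps)
      moreover have "h * (real k + 1) - h * (real n - 1 - real i) \<le> h * (real n - real k - real i)"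
        using i mult_left_mono[OF i h] by (simp add: algebra_simps)
      ultimately show ?thesis by linarith
    qed
    moreover have "h * (real n - 1 - real i) - x * n \<le> h * (real n - real k - real i)"
    proof -
      have "h * real k \<le> x * n"
        using x(1) n by (simp add: field_simps)
      then show ?thesis
        using h by (simp add: algebra_simps)
    qed
    ultimately have "\<bar>x * n - h * (real n - 1 - real i)\<bar> \<le> h * (real n - real k - real i)"
      by linarith
    then have "\<bar>x - h * (real n - 1 - real i) / real n\<bar> \<le> h * (real n - real k - real i) / n"
      using n by (simp add: divide_simps abs_mult)
    then have "\<bar>g i\<bar> \<le> 2 ^ i / 2 ^ n * (h * (real n - real k - real i) / n)"
      unfolding g_def abs_mult by (intro mult_mono) auto
    then show "\<bar>g i\<bar> \<le> h / (2 ^ n * n) * (2 ^ i * (real (n - k) - real i))"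
      using k by (simp add: of_nat_diff field_simps)
  qed
  also have "\<dots> = h / (2 ^ n * n) * (\<Sum>i<n - k. (2 ^ i * (real (n - k) - real i)))"
    by (simp add: sum_distrib_left)
  also have "\<dots> \<le> h / (2 ^ n * n) * (2 * 2 ^ (n - k))"
    using h by (intro mult_left_mono sum_power2_mult_diff) auto
  also have "\<dots> = 2 * h / (2 ^ k * n)"
    using k by (simp add: power_diff mult.commute)
  finally show ?thesis .
qed

text \<open>Over the strip with index \<open>k\<close> only the \<open>k\<close> leading digits
  matter, so \<open>2 ^ k\<close> pieces, fattened by the truncation error on both sides, replace
  the \<open>2 ^ n\<close> tubes.\<close>

lemma kakeya_set_subset:
  assumes n: "0 < n" and h: "0 < h"
  shows "kakeya_set n h w \<subseteq>
    (\<Union>k<n. \<Union>P\<in>Pow {n - k..<n}. parallelogram (slope n P) (h * real k / n) (h * (real k + 1) / n)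
       (h * offset n P - 2 * h / (2 ^ k * n)) (h * offset n P + w + 2 * h / (2 ^ k * n)))"
proof
  fix z assume "z \<in> kakeya_set n h w"
  then obtain S where S: "S \<subseteq> {..<n}"
    and z: "z \<in> parallelogram (slope n S) 0 h (h * offset n S) (h * offset n S + w)"
    by (auto simp: kakeya_set_def)
  \<comment> \<open>Rounding down \<open>z$1 * n / h\<close> finds the strip, except at the right
    end \<open>z$1 = h\<close>, where it would give \<open>k = n\<close>.\<close>
  have "\<exists>k<n. h * real k / n \<le> z$1 \<and> z$1 \<le> h * (real k + 1) / n"
  proof (cases "z$1 = h")
    case True
    then show ?thesis
      using n h by (intro exI[of _ "n - 1"]) (simp add: field_simps of_nat_diff)
  next
    case False
    define k where "k = nat \<lfloor>z$1 * n / h\<rfloor>"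
    have pos: "0 \<le> z$1 * n / h"
      using z h by (simp add: parallelogram_def)
    have "z$1 * n / h < n"
      using z False n h by (simp add: parallelogram_def field_simps)
    then have "k < n"
      using pos by (simp add: k_def) linarith
    moreover have "real k \<le> z$1 * n / h" "z$1 * n / h \<le> real k + 1"
      using pos by (simp_all add: k_def)
    ultimately show ?thesis
      using n h by (intro exI[of _ k]) (simp add: field_simps)
  qed
  then obtain k where k: "k < n" "h * real k / n \<le> z$1" "z$1 \<le> h * (real k + 1) / n"
    by blast
  define P where "P = S \<inter> {n - k..<n}"
  have "\<bar>(slope n S * z$1 + h * offset n S) - (slope n P * z$1 + h * offset n P)\<bar> \<le> 2 * h / (2 ^ k * n)"
    unfolding P_def using h by (intro digit_truncation S k) simp
  moreover have "h * offset n S \<le> z$2 - slope n S * z$1" "z$2 - slope n S * z$1 < h * offset n S + w"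
    using z by (simp_all add: parallelogram_def)
  ultimately have "h * offset n P - 2 * h / (2 ^ k * n) \<le> z$2 - slope n P * z$1"
    "z$2 - slope n P * z$1 < h * offset n P + w + 2 * h / (2 ^ k * n)"
    by linarith+
  then have "z \<in> parallelogram (slope n P) (h * real k / n) (h * (real k + 1) / n)
       (h * offset n P - 2 * h / (2 ^ k * n)) (h * offset n P + w + 2 * h / (2 ^ k * n))"
    using k by (simp add: parallelogram_def)
  then show "z \<in> (\<Union>k<n. \<Union>P\<in>Pow {n - k..<n}. parallelogram (slope n P) (h * real k / n) (h * (real k + 1) / n)
       (h * offset n P - 2 * h / (2 ^ k * n)) (h * offset n P + w + 2 * h / (2 ^ k * n)))"
    using k(1) by (intro UN_I[of k] UN_I[of P]) (auto simp: P_def)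
qed

text \<open>The \<open>2 ^ k\<close> pieces over a strip of width \<open>h / n\<close> have height
  \<open>4 * h / (2 ^ k * n) + w\<close>. The powers of 2 cancel in the first part, which leaves
  \<open>4 * h^2 / n^2\<close> per strip; summed over \<open>n\<close> strips this is the gain of a
  factor \<open>1 / n\<close>.\<close>

lemma emeasure_kakeya_set_le:
  assumes n: "0 < n" and h: "0 < h" and w: "0 \<le> w"
  shows "emeasure lborel (kakeya_set n h w) \<le> ennreal (4 * h\<^sup>2 / n + h * w * 2 ^ n / n)"
proof -
  let ?P = "\<lambda>k P. parallelogram (slope n P) (h * real k / n) (h * (real k + 1) / n)
       (h * offset n P - 2 * h / (2 ^ k * n)) (h * offset n P + w + 2 * h / (2 ^ k * n))"
  have area: "emeasure lborel (?P k P) = ennreal (h / n * (4 * h / (2 ^ k * n) + w))" for k P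
  proof -
    have "0 \<le> 2 * h / (2 ^ k * n)"
      using h by simp
    then have "emeasure lborel (?P k P) = 
      ennreal ((h * (real k + 1) / n - h * real k / n) * 
       ((h * offset n P + w + 2 * h / (2 ^ k * n)) - (h * offset n P - 2 * h / (2 ^ k * n))))"
      using h w by (intro emeasure_parallelogram) (auto simp: divide_right_mono)
    also have "(h * (real k + 1) / n - h * real k / n) = h / n"
      by (simp add: distrib_left add_divide_distrib)
    also have "((h * offset n P + w + 2 * h / (2 ^ k * n)) - (h * offset n P - 2 * h / (2 ^ k * n)))
      = 4 * h / (2 ^ k * n) + w"
      by (simp add: field_simps)
    finally show ?thesis .
  qed
  have "emeasure lborel (kakeya_set n h w) \<le> emeasure lborel (\<Union>k<n. \<Union>P\<in>Pow {n - k..<n}. ?P k P)"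
    by (intro emeasure_mono kakeya_set_subset n h) (auto intro!: sets.finite_UN)
  also have "\<dots> \<le> (\<Sum>k<n. emeasure lborel (\<Union>P\<in>Pow {n - k..<n}. ?P k P))"
    by (intro emeasure_subadditive_finite) (auto intro!: sets.finite_UN)
  also have "\<dots> \<le> (\<Sum>k<n. \<Sum>P\<in>Pow {n - k..<n}. emeasure lborel (?P k P))"
    by (intro sum_mono emeasure_subadditive_finite) auto
  also have "\<dots> = (\<Sum>k<n. ennreal (2 ^ k * (h / n * (4 * h / (2 ^ k * n) + w))))"
  proof (intro sum.cong refl)
    fix k assume "k \<in> {..<n}"
    then have "card (Pow {n - k..<n}) = 2 ^ k"
      by (simp add: card_Pow)
    then show "(\<Sum>P\<in>Pow {n - k..<n}. emeasure lborel (?P k P))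
       = ennreal (2 ^ k * (h / n * (4 * h / (2 ^ k * n) + w)))"
      unfolding area sum_constant using h w
      by (subst ennreal_mult) (simp_all flip: ennreal_power)
  qed
  also have "\<dots> = ennreal (\<Sum>k<n. 2 ^ k * (h / n * (4 * h / (2 ^ k * n) + w)))"
    using h w by (intro sum_ennreal) auto
  also have "(\<Sum>k<n. 2 ^ k * (h / n * (4 * h / (2 ^ k * n) + w)))
      = (\<Sum>k<n. 4 * h\<^sup>2 / n / n + h * w / n * 2 ^ k)"
    using n by (intro sum.cong refl) (simp add: field_simps power2_eq_square)
  also have "\<dots> = 4 * h\<^sup>2 / n + h * w / n * (\<Sum>k<n. 2 ^ k)"
    unfolding sum.distrib sum_distrib_left[symmetric] using n by simp
  also have "\<dots> = 4 * h\<^sup>2 / n + h * w / n * (2 ^ n - 1)"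
    by (simp add: geometric_sum)
  also have "\<dots> \<le> 4 * h\<^sup>2 / n + h * w * 2 ^ n / n"
    using n h w by (simp add: field_simps)
  finally show ?thesis
    by (simp add: ennreal_leI)
qed

subsection \<open>Circular means and tangent circles\<close>

lemma borel_measurable_circle_point [measurable]:
  "(\<lambda>\<theta>. vector [cos \<theta>, sin \<theta>] :: real^2) \<in> borel_measurable borel"
proof (intro borel_measurable_continuous_onI)
  have "(vector [cos \<theta>, sin \<theta>] :: real^2) = (\<chi> i. if i = 1 then cos \<theta> else sin \<theta>)" for \<theta>
    by (simp add: vec_eq_iff forall_2)
  then show "continuous_on UNIV (\<lambda>\<theta>. vector [cos \<theta>, sin \<theta>] :: real^2)"
    by (simp only:) (intro continuous_on_vec_lambda, case_tac "i = 1", auto intro!: continuous_intros)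
qed

lemma sets_circle_measure [measurable_cong, simp]: "sets circle_measure = sets borel"
  by (simp add: circle_measure_def)

lemma measure_circle_measure:
  assumes [measurable]: "A \<in> sets borel"
  shows "measure circle_measure A = measure lborel ({0..<2 * pi} \<inter> {\<theta>. vector [cos \<theta>, sin \<theta>] \<in> A}) / (2 * pi)"
proof -
  have [measurable]: "{\<theta>. vector [cos \<theta>, sin \<theta>] \<in> A} \<in> sets borel"
    using measurable_sets[OF borel_measurable_circle_point assms] by (simp add: vimage_def)
  have "measure circle_measure A
    = measure (uniform_measure lborel {0..<2 * pi}) {\<theta>. vector [cos \<theta>, sin \<theta>] \<in> A}"
    unfolding circle_measure_def by (subst measure_distr) (auto simp: vimage_def)
  also have "\<dots> = measure lborel ({0..<2 * pi} \<inter> {\<theta>. vector [cos \<theta>, sin \<theta>] \<in> A}) / (2 * pi)"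
    by (subst measure_uniform_measure) auto
  finally show ?thesis .
qed

lemma circular_mean_indicator:
  assumes [measurable]: "F \<in> sets borel"
  shows "circular_mean t (indicator F) x = of_real (measure circle_measure {y. x - t *\<^sub>R y \<in> F})"
proof -
  have "(\<lambda>y. x - t *\<^sub>R y) \<in> borel_measurable (borel :: (real^2) measure)"
    by measurable
  from measurable_sets[OF this assms]
  have S: "{y. x - t *\<^sub>R y \<in> F} \<in> sets borel" 
    by (simp add: vimage_def)
  have "circular_mean t (indicator F) x
    = (LINT y|circle_measure. indicator {y. x - t *\<^sub>R y \<in> F} y)"
    unfolding circular_mean_def by (intro Bochner_Integration.integral_cong) (auto simp: indicator_def)
  also have "\<dots> = (LINT y|circle_measure. complex_of_real (indicator {y. x - t *\<^sub>R y \<in> F} y))"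
    by (intro Bochner_Integration.integral_cong) (auto simp: indicator_def)
  also have "\<dots> = of_real (measure circle_measure {y. x - t *\<^sub>R y \<in> F})"
    using S sets_eq_imp_space_eq[OF sets_circle_measure] by (simp only: integral_complex_of_real) simp
  finally show ?thesis .
qed

text \<open>The circle measure is normalised angle, so an arc inside \<open>F\<close> contributes
  its share of \<open>2 * pi\<close>. The bounds on \<open>a\<close> and \<open>b\<close> prevent it
  from wrapping around.\<close>

lemma circular_mean_indicator_ge:
  assumes F: "F \<in> sets borel"
    and ab: "0 \<le> a" "a \<le> b" "b < 2 * pi"
    and arc: "\<And>\<psi>. a \<le> \<psi> \<Longrightarrow> \<psi> \<le> b \<Longrightarrow> x - t *\<^sub>R vector [cos \<psi>, sin \<psi>] \<in> F"
  shows "(b - a) / (2 * pi) \<le> cmod (circular_mean t (indicator F) x)"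
proof -
  have "(\<lambda>y. x - t *\<^sub>R y) \<in> borel_measurable (borel :: (real^2) measure)"
    by measurable
  from measurable_sets[OF this F]
  have S: "{y. x - t *\<^sub>R y \<in> F} \<in> sets borel" 
    by (simp add: vimage_def)
  let ?B = "{0..<2 * pi} \<inter> {\<theta>. vector [cos \<theta>, sin \<theta>] \<in> {y. x - t *\<^sub>R y \<in> F}}"
  have B: "?B \<in> sets borel"
    using measurable_sets[OF borel_measurable_circle_point S] by (auto simp: vimage_def)
  have "b - a = measure lborel {a..b}"
    using ab by simp
  also have "\<dots> \<le> measure lborel ?B"
  proof (rule measure_mono_fmeasurable)
    show "{a..b} \<subseteq> ?B"
    proof
      fix \<psi> assume "\<psi> \<in> {a..b}"
      then have "a \<le> \<psi>" "\<psi> \<le> b"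
        by auto
      then show "\<psi> \<in> ?B"
        using arc[of \<psi>] ab by simp
    qed
    have "{0..2 * pi} \<in> fmeasurable lborel"
      by (intro fmeasurableI) (simp_all add: emeasure_lborel_Icc_eq)
    then show "?B \<in> fmeasurable lborel"
      by (rule fmeasurableI2) (use B in auto)
  qed simp
  finally have "(b - a) / (2 * pi) \<le> measure lborel ?B / (2 * pi)"
    by (intro divide_right_mono) auto
  then show ?thesis
    unfolding circular_mean_indicator[OF F] norm_of_real measure_circle_measure[OF S]
    by (rule order_trans[OF _ abs_ge_self])
qed

section \<open>Centres of circles tangent to a tube\<close>

lemma cos_ge_one_minus_square: "1 - x\<^sup>2 / 2 \<le> cos (x::real)"
proof -
  have "(sin (x / 2))\<^sup>2 \<le> (x / 2)\<^sup>2"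
    using abs_sin_x_le_abs_x[of "x / 2"] abs_le_square_iff by blast
  then show ?thesis
    using cos_double_sin[of "x / 2"] by (simp add: power2_eq_square)
qed

text \<open>Contains only centres \<open>z\<close> for which all circles of radius in \<open>[\<tau>, \<tau> + h\<^sup>2)\<close> about \<open>z\<close> follow the tube
  of slope \<open>a\<close>; the factor \<open>sqrt (1 + a\<^sup>2)\<close> turns a radius, measured along the normal of the tube, into a
  vertical distance.\<close>

definition center_set :: "real \<Rightarrow> real \<Rightarrow> real \<Rightarrow> real \<Rightarrow> (real^2) set" where
  "center_set a b h \<tau> =
     parallelogram a (- \<tau> * sin (arctan a)) (h / 4 - \<tau> * sin (arctan a))
       (h * b + sqrt (1 + a\<^sup>2) * (\<tau> + h\<^sup>2)) (h * b + sqrt (1 + a\<^sup>2) * (\<tau> + 2 * h\<^sup>2))"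

lemma center_set_borel [measurable]: "center_set a b h \<tau> \<in> sets borel"
  by (simp add: center_set_def)

lemma emeasure_center_set_ge:
  assumes "0 < h"
  shows "ennreal (h ^ 3 / 4) \<le> emeasure lborel (center_set a b h \<tau>)"
proof -
  have "h ^ 3 / 4 \<le> h / 4 * (sqrt (1 + a\<^sup>2) * h\<^sup>2)"
    using assms by (simp add: power3_eq_cube power2_eq_square)
  also have "ennreal \<dots> = emeasure lborel (center_set a b h \<tau>)"
    unfolding center_set_def using assms
    by (subst emeasure_parallelogram) (auto intro!: mult_left_mono simp: algebra_simps)
  finally show ?thesis
    using ennreal_leI by auto
qed

text \<open>With slope and offset fixed, the half-open vertical range moves with the radius, and its
  height is \<open>h^2\<close> times the same factor \<open>sqrt (1 + a\<^sup>2)\<close>.\<close>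

lemma center_set_disjoint_radius:
  assumes "z \<in> center_set a b h \<tau>" "z \<in> center_set a b h \<tau>'"
  shows "\<bar>\<tau> - \<tau>'\<bar> < h\<^sup>2"
proof -
  have "0 < sqrt (1 + a\<^sup>2)"
    by (simp add: add_pos_nonneg)
  moreover have "sqrt (1 + a\<^sup>2) * (\<tau> + h\<^sup>2) < sqrt (1 + a\<^sup>2) * (\<tau>' + 2 * h\<^sup>2)"
    "sqrt (1 + a\<^sup>2) * (\<tau>' + h\<^sup>2) < sqrt (1 + a\<^sup>2) * (\<tau> + 2 * h\<^sup>2)"
    using assms by (auto simp: center_set_def parallelogram_def)
  ultimately have "\<tau> + h\<^sup>2 < \<tau>' + 2 * h\<^sup>2" "\<tau>' + h\<^sup>2 < \<tau> + 2 * h\<^sup>2"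
    by (simp_all only: mult_less_cancel_left_pos)
  then show ?thesis
    by linarith
qed

lemma sqrt_one_plus_square_bounds:
  fixes a :: real
  assumes "0 \<le> a" "a \<le> 1"
  shows "1 \<le> sqrt (1 + a\<^sup>2)" "sqrt (1 + a\<^sup>2) < 3 / 2"
proof -
  have "a\<^sup>2 \<le> 1"
    using assms by (simp add: power_le_one)
  then show "sqrt (1 + a\<^sup>2) < 3 / 2"
    by (intro real_less_lsqrt) (auto simp: power2_eq_square)
qed simp

text \<open>At \<open>\<phi> = 0\<close> the point is the one on the lower half of the circle where
  the tangent has slope \<open>a\<close>. Turning by \<open>\<phi>\<close> advances it horizontally
  by at most \<open>2 * \<phi>\<close>, but takes it off the tangent only to second order in
  \<open>\<phi>\<close>.\<close>

lemma arc_in_tube: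
  assumes a: "0 \<le> a" "a \<le> 1" and h: "0 < h" "h \<le> 1 / 16"
    and t: "\<tau> \<le> t" "t < \<tau> + h\<^sup>2" "0 < t" "t < 2"
    and z: "z \<in> center_set a b h \<tau>"
    and \<phi>: "0 \<le> \<phi>" "\<phi> \<le> h / 4"
    and \<psi>: "\<psi> = pi / 2 + (arctan a + \<phi>)"
  shows "z - t *\<^sub>R vector [cos \<psi>, sin \<psi>] \<in> parallelogram a 0 h (h * b) (h * b + 4 * h\<^sup>2)"
proof -
  define \<theta> where "\<theta> = arctan a"
  define q where "q = sqrt (1 + a\<^sup>2)"
  have q: "1 \<le> q" "q < 3 / 2"
    unfolding q_def using sqrt_one_plus_square_bounds[OF a] by blast+
  have cos\<theta>: "cos \<theta> = 1 / q" and sin\<theta>: "sin \<theta> = a / q"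
    by (simp_all add: \<theta>_def q_def cos_arctan sin_arctan)
  have q2: "1 + a * a = q * q"
    by (simp add: q_def power2_eq_square[symmetric])
  have hh: "h\<^sup>2 \<le> h / 16" "0 < h\<^sup>2"
    using h by (simp_all add: power2_eq_square)
  have angle: "0 \<le> \<theta>" "\<theta> \<le> pi / 4"
    using a arctan_monotone'[of a 1] by (simp_all add: \<theta>_def arctan_one)
  have small: "\<phi> \<le> pi / 4"
    using \<phi> h pi_gt3 by simp
  have cos\<psi>: "cos \<psi> = - sin (\<theta> + \<phi>)" and sin\<psi>: "sin \<psi> = cos (\<theta> + \<phi>)"
    by (simp_all add: \<psi> \<theta>_def cos_add sin_add)
  define x where "x = z$1 + t * sin (\<theta> + \<phi>)"
  define y where "y = z$2 - t * cos (\<theta> + \<phi>)"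
  have z': "0 \<le> z$1 + \<tau> * sin \<theta>" "z$1 + \<tau> * sin \<theta> \<le> h / 4"
    "q * (\<tau> + h\<^sup>2) \<le> z$2 - a * z$1 - h * b" "z$2 - a * z$1 - h * b < q * (\<tau> + 2 * h\<^sup>2)"
    using z by (auto simp: center_set_def parallelogram_def \<theta>_def q_def)
  have sin_nonneg: "0 \<le> sin \<theta>" "sin \<theta> \<le> 1"
    using angle by (auto intro!: sin_ge_zero)
  have "sin \<theta> \<le> sin (\<theta> + \<phi>)"
    using angle \<phi> small by (intro sin_monotone_2pi_le) auto
  moreover have "sin (\<theta> + \<phi>) \<le> sin \<theta> + \<phi>"
  proof -
    have "sin \<theta> * cos \<phi> \<le> sin \<theta>"
      using sin_nonneg by (simp add: mult_left_le)
    moreover have "0 \<le> sin \<phi>"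
      using \<phi> small by (intro sin_ge_zero) auto
    then have "cos \<theta> * sin \<phi> \<le> 1 * sin \<phi>"
      by (intro mult_right_mono) auto
    then have "cos \<theta> * sin \<phi> \<le> \<phi>"
      using sin_x_le_x[OF \<phi>(1)] by simp
    ultimately show ?thesis
      by (simp add: sin_add)
  qed
  ultimately have "0 \<le> t * (sin (\<theta> + \<phi>) - sin \<theta>)" "t * (sin (\<theta> + \<phi>) - sin \<theta>) \<le> 2 * \<phi>"
    using t by (auto intro!: mult_mono)
  moreover have "0 \<le> (t - \<tau>) * sin \<theta>" "(t - \<tau>) * sin \<theta> \<le> h\<^sup>2 * 1"
    using t sin_nonneg hh by (auto intro!: mult_mono simp del: mult_1_right)
  \<comment> \<open>Position of the centre, excess of the radius over \<open>\<tau>\<close>, travel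
    along the arc: at most \<open>h / 4\<close>, \<open>h^2 \<le> h / 16\<close> and
    \<open>h / 2\<close>.\<close>
  moreover have "x = (z$1 + \<tau> * sin \<theta>) + (t - \<tau>) * sin \<theta> + t * (sin (\<theta> + \<phi>) - sin \<theta>)"
    by (simp add: x_def algebra_simps)
  ultimately have x: "0 \<le> x" "x \<le> h"
    using z' \<phi> hh h by linarith+
  \<comment> \<open>Since \<open>a = tan \<theta>\<close> and \<open>q = 1 / cos \<theta>\<close>,
    this is the component of the radius direction along the normal of the tube, turned by
    \<open>q\<close> into a vertical distance.\<close>
  have rot: "cos (\<theta> + \<phi>) + a * sin (\<theta> + \<phi>) = q * cos \<phi>"
  proof -
    have "cos (\<theta> + \<phi>) + a * sin (\<theta> + \<phi>) = (1 + a * a) / q * cos \<phi>"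
      unfolding cos_add sin_add cos\<theta> sin\<theta> using q by (simp add: field_simps)
    then show ?thesis
      unfolding q2 using q by simp
  qed
  have y: "y - a * x = (z$2 - a * z$1) - t * (q * cos \<phi>)"
    unfolding rot[symmetric] by (simp add: x_def y_def algebra_simps)
  have "t * cos \<phi> \<le> t"
    using t by (simp add: mult_left_le)
  then have "t * cos \<phi> \<le> \<tau> + h\<^sup>2"
    using t by linarith
  then have "q * (t * cos \<phi>) \<le> q * (\<tau> + h\<^sup>2)"
    using q by (intro mult_left_mono) auto
  then have "h * b \<le> y - a * x"
    using z' by (simp add: y algebra_simps)
  \<comment> \<open>The range of centres costs \<open>2 * h^2\<close> and the curvature
    \<open>h^2 / 16\<close>; with \<open>q < 3 / 2\<close> the total is at most
    \<open>99 / 32 * h^2\<close>, which fits into the width \<open>4 * h^2\<close>.\<close>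
  moreover have "q * (\<tau> + 2 * h\<^sup>2) - q * (t * cos \<phi>) \<le> 4 * h\<^sup>2"
  proof -
    have "\<phi>\<^sup>2 \<le> (h / 4)\<^sup>2"
      using \<phi> by (intro power_mono) auto
    then have "1 - h\<^sup>2 / 32 \<le> cos \<phi>"
      using cos_ge_one_minus_square[of \<phi>] by (simp add: power2_eq_square)
    then have "t * (1 - h\<^sup>2 / 32) \<le> t * cos \<phi>"
      using t by (intro mult_left_mono) auto
    moreover have "t * h\<^sup>2 \<le> 2 * h\<^sup>2"
      using t by (intro mult_right_mono) auto
    ultimately have "\<tau> + 2 * h\<^sup>2 - t * cos \<phi> \<le> 2 * h\<^sup>2 + h\<^sup>2 / 16"
      using t by (simp add: algebra_simps)
    then have "q * (\<tau> + 2 * h\<^sup>2 - t * cos \<phi>) \<le> q * (2 * h\<^sup>2 + h\<^sup>2 / 16)"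
      using q by (intro mult_left_mono) auto
    also have "\<dots> \<le> 3 / 2 * (2 * h\<^sup>2 + h\<^sup>2 / 16)"
      using q by (intro mult_right_mono) auto
    also have "\<dots> \<le> 4 * h\<^sup>2"
      using hh(2) by (simp add: field_simps)
    finally show ?thesis
      by (simp only: right_diff_distrib)
  qed
  ultimately have "h * b \<le> y - a * x" "y - a * x < h * b + 4 * h\<^sup>2"
    using z' by (simp_all add: y algebra_simps)
  then show ?thesis
    using x unfolding parallelogram_def x_def y_def cos\<psi> sin\<psi> by simp
qed

text \<open>Up to errors of order \<open>h\<close>, \<open>z\<close> is \<open>\<tau>\<close> times
  the unit normal \<open>(- a, 1) / sqrt (1 + a\<^sup>2)\<close>. It is therefore almost orthogonal
  to \<open>(1, a)\<close>, and its direction reveals the slope.\<close>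

lemma center_set_direction:
  assumes a: "0 \<le> a" "a \<le> 1" and b: "-1 \<le> b" "b \<le> 0" and h: "0 < h" "h \<le> 1 / 16" and \<tau>: "1 \<le> \<tau>"
    and z: "z \<in> center_set a b h \<tau>"
  shows "1 / 2 \<le> z$2" "\<bar>z$1 + a * z$2\<bar> \<le> h"
proof -
  define q where "q = sqrt (1 + a\<^sup>2)"
  have q: "1 \<le> q" "q < 3 / 2"
    unfolding q_def using sqrt_one_plus_square_bounds[OF a] by blast+
  have q2: "1 + a * a = q * q"
    by (simp add: q_def power2_eq_square[symmetric])
  have hh: "h\<^sup>2 \<le> h / 16" "0 < h\<^sup>2"
    using h by (simp_all add: power2_eq_square)
  \<comment> \<open>For \<open>u = w = 0\<close> the centre is exactly \<open>\<tau>\<close> times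
    the unit normal, raised by \<open>h * b\<close>.\<close>
  define u where "u = z$1 + \<tau> * (a / q)"
  define w where "w = z$2 - a * z$1 - h * b - q * \<tau>"
  have u: "0 \<le> u" "u \<le> h / 4"
    using z by (auto simp: center_set_def parallelogram_def q_def sin_arctan u_def)
  have w': "q * h\<^sup>2 \<le> w" "w \<le> q * (2 * h\<^sup>2)"
    using z by (auto simp: center_set_def parallelogram_def q_def w_def algebra_simps)
  have w: "0 \<le> w" "w \<le> 3 * h\<^sup>2"
  proof -
    show "0 \<le> w"
      using order_trans[OF _ w'(1), of 0] q by simp
    have "q * (2 * h\<^sup>2) \<le> 3 / 2 * (2 * h\<^sup>2)"
      using q by (intro mult_right_mono) auto
    then show "w \<le> 3 * h\<^sup>2"
      using w' by simp
  qed
  have z1: "z$1 = u - \<tau> * (a / q)"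
    by (simp add: u_def)
  have z2: "z$2 = \<tau> / q + a * u + h * b + w"
  proof -
    have "q * \<tau> - a * (\<tau> * (a / q)) = \<tau> * (q * q - a * a) / q"
      using q by (simp add: field_simps)
    also have "q * q - a * a = 1"
      using q2 by simp
    finally have "q * \<tau> - a * (\<tau> * (a / q)) = \<tau> / q"
      by simp
    moreover have "z$2 = w + h * b + a * u + (q * \<tau> - a * (\<tau> * (a / q)))"
      by (simp add: w_def z1 algebra_simps)
    ultimately show ?thesis
      by simp
  qed
  have hb: "- h \<le> h * b" "h * b \<le> 0"
    using b h mult_left_mono[of "-1" b h] by (simp_all add: mult_nonneg_nonpos)
  have au: "0 \<le> a * u" "a * u \<le> h / 4"
    using a u mult_left_le_one_le[of u a] by auto
  have "2 / 3 \<le> \<tau> / q"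
    using q \<tau> by (simp add: field_simps)
  then show "1 / 2 \<le> z$2"
    using z2 hb au w h by linarith
  have "z$1 + a * z$2 = u + a * (a * u + h * b + w)"
    by (simp add: z1 z2 algebra_simps)
  moreover have "- h \<le> a * u + h * b + w" "a * u + h * b + w \<le> h / 2"
    using hb au w hh h by linarith+
  then have "a * - h \<le> a * (a * u + h * b + w) \<and> a * (a * u + h * b + w) \<le> a * (h / 2)"
    using a(1) by (intro conjI mult_left_mono) assumption+
  moreover have "a * h \<le> h"
    using a h by (simp add: mult_left_le_one_le)
  ultimately show "\<bar>z$1 + a * z$2\<bar> \<le> h"
    using u h by linarith
qed

text \<open>The two near-orthogonality relations differ by \<open>(a - a') * z$2\<close>, and
  \<open>z$2\<close> is at least \<open>1 / 2\<close>.\<close>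

lemma center_set_disjoint_slope:
  assumes "0 \<le> a" "a \<le> 1" "-1 \<le> b" "b \<le> 0" "0 \<le> a'" "a' \<le> 1" "-1 \<le> b'" "b' \<le> 0"
    and "0 < h" "h \<le> 1 / 16" "1 \<le> \<tau>" "1 \<le> \<tau>'"
    and "z \<in> center_set a b h \<tau>" "z \<in> center_set a' b' h \<tau>'"
  shows "\<bar>a - a'\<bar> \<le> 4 * h"
proof -
  have z: "1 / 2 \<le> z$2" "\<bar>z$1 + a * z$2\<bar> \<le> h" "\<bar>z$1 + a' * z$2\<bar> \<le> h"
    using center_set_direction assms by blast+
  have "\<bar>a - a'\<bar> * (1 / 2) \<le> \<bar>a - a'\<bar> * z$2"
    using z by (intro mult_left_mono) auto
  also have "\<dots> = \<bar>(z$1 + a * z$2) - (z$1 + a' * z$2)\<bar>"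
    using z by (simp add: abs_mult flip: left_diff_distrib)
  also have "\<dots> \<le> 2 * h"
    using z by linarith
  finally show ?thesis
    by simp
qed

subsection \<open>Lorentz quasinorms of indicators\<close>

lemma distribution_fn_indicator_le:
  assumes F: "F \<in> sets borel"
  shows "distribution_fn lborel (\<lambda>x. ennreal (cmod (indicator F x))) s \<le> (if s < 1 then emeasure lborel F else 0)"
proof (cases "s < 1")
  case True
  have "distribution_fn lborel (\<lambda>x. ennreal (cmod (indicator F x))) s \<le> outer_measure_of lborel F"
    unfolding distribution_fn_def
    by (intro outer_measure_of_mono) (auto simp: indicator_def split: if_splits)
  then show ?thesis
    using F True by simp
next
  case False
  then have "{x \<in> space lborel. s < ennreal (cmod (indicator F x))} = {}"
    by (auto simp: indicator_def not_less)
  then show ?thesis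
    using False by (simp add: distribution_fn_def)
qed

text \<open>The rearrangement is at most 1 and vanishes from \<open>m\<close> on, while
  \<open>t powr (- 1 / 2)\<close> has integral \<open>2 * sqrt m\<close> over
  \<open>{0..m}\<close>.\<close>

lemma lorentz_1_indicator_le:
  assumes F: "F \<in> sets borel" and m: "emeasure lborel F \<le> ennreal m" "0 \<le> m"
  shows "lorentz_1 2 lborel (\<lambda>x. ennreal (cmod (indicator F x))) \<le> ennreal (2 * sqrt m)"
proof -
  let ?g = "\<lambda>x. ennreal (cmod (indicator F x))"
  have le1: "decreasing_rearrangement lborel ?g t \<le> 1" for t
    unfolding decreasing_rearrangement_def
    using distribution_fn_indicator_le[OF F, of 1] by (intro Inf_lower) auto
  have zero: "decreasing_rearrangement lborel ?g t = 0" if "m \<le> t" for t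
  proof -
    have "distribution_fn lborel ?g 0 \<le> ennreal t"
      using distribution_fn_indicator_le[OF F, of 0] m that
      by simp (meson ennreal_leI order_trans)
    then have "decreasing_rearrangement lborel ?g t \<le> 0"
      unfolding decreasing_rearrangement_def by (intro Inf_lower) auto
    then show ?thesis by simp
  qed
  have "lorentz_1 2 lborel ?g \<le> (\<integral>\<^sup>+t. ennreal (t powr (- 1 / 2)) * indicator {0..m} t \<partial>lborel)"
    unfolding lorentz_1_def
  proof (intro nn_integral_mono)
    fix t :: real
    consider "t \<le> 0" | "0 < t" "t < m" | "m \<le> t" "0 < t"
      by linarith
    then show "ennreal (t powr (1 / 2)) * decreasing_rearrangement lborel ?g t * ennreal (1 / t) * indicator {0<..} t
      \<le> ennreal (t powr (- 1 / 2)) * indicator {0..m} t"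
    proof cases
      case 2
      then have "t powr (1 / 2) * (1 / t) = t powr (- 1 / 2)"
        using powr_add[of t "1 / 2" "- 1"] powr_minus_divide[of t 1] by simp
      then have "ennreal (t powr (- 1 / 2)) = ennreal (t powr (1 / 2)) * 1 * ennreal (1 / t)"
        by (metis ennreal_mult' mult.right_neutral powr_ge_zero)
      moreover have "ennreal (t powr (1 / 2)) * decreasing_rearrangement lborel ?g t * ennreal (1 / t)
        \<le> ennreal (t powr (1 / 2)) * 1 * ennreal (1 / t)"
        by (intro mult_mono le1) auto
      ultimately show ?thesis
        using 2 by simp
    qed (auto simp: zero)
  qed
  also have "\<dots> = ennreal (m powr (- 1 / 2 + 1) / (- 1 / 2 + 1))"
    by (intro nn_integral_has_integral_lebesgue' has_integral_powr_from_0) (use m in auto)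
  also have "m powr (- 1 / 2 + 1) / (- 1 / 2 + 1) = 2 * sqrt m"
    using m by (simp add: powr_half_sqrt)
  finally show ?thesis .
qed

text \<open>A level below \<open>\<alpha>\<close> is exceeded on all of \<open>G\<close>, so its
  distribution value is above \<open>t\<close>; this uses the strict inequality for
  \<open>t\<close>. Monotonicity of the outer measure suffices, so \<open>g\<close> may be
  nonmeasurable.\<close>

lemma lorentz_inf_ge:
  assumes G: "G \<in> sets borel" and t: "0 < t" "ennreal t < emeasure lborel G"
    and g: "\<And>x. x \<in> G \<Longrightarrow> \<alpha> \<le> g x"
  shows "ennreal (sqrt t) * \<alpha> \<le> lorentz_inf 2 lborel g"
proof -
  have "\<alpha> \<le> decreasing_rearrangement lborel g t"
    unfolding decreasing_rearrangement_def
  proof (intro Inf_greatest, unfold mem_Collect_eq)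
    fix s assume s: "distribution_fn lborel g s \<le> ennreal t"
    show "\<alpha> \<le> s"
    proof (rule ccontr)
      assume "\<not> \<alpha> \<le> s"
      then have "G \<subseteq> {x \<in> space lborel. s < g x}"
        using g by (auto simp: not_le intro: less_le_trans)
      then have "emeasure lborel G \<le> distribution_fn lborel g s"
        unfolding distribution_fn_def using outer_measure_of_mono[of G _ lborel] G by simp
      then show False
        using s t by (meson leD order_trans)
    qed
  qed
  then have "ennreal (sqrt t) * \<alpha> \<le> ennreal (t powr (1 / 2)) * decreasing_rearrangement lborel g t"
    using t by (intro mult_mono) (auto simp: powr_half_sqrt)
  also have "\<dots> \<le> lorentz_inf 2 lborel g"
    unfolding lorentz_inf_def using t by (intro SUP_upper) auto
  finally show ?thesis .
qed

subsection \<open>The lower bound for the maximal function\<close>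

definition centers :: "nat \<Rightarrow> real \<Rightarrow> nat set \<Rightarrow> (real^2) set" where
  "centers n h I = (\<Union>(S, i)\<in>Pow {..<n} \<times> I. center_set (slope n S) (offset n S) h (1 + real i * h\<^sup>2))"

text \<open>The \<open>2 ^ n * card I\<close> centre sets are pairwise disjoint with area at least
  \<open>h ^ 3 / 4\<close> each, and \<open>2 ^ n * h = 1 / 8\<close>.\<close>

lemma emeasure_centers_ge:
  assumes h: "h = 1 / (8 * 2 ^ n)" and n: "0 < n" and I: "finite I"
  shows "ennreal (real (card I) * h\<^sup>2 / 32) \<le> emeasure lborel (centers n h I)"
    and "centers n h I \<in> sets borel"
proof -
  let ?A = "\<lambda>(S, i). center_set (slope n S) (offset n S) h (1 + real i * h\<^sup>2)"
  have h0: "0 < h" 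
    by (simp add: h)
  have "(2::real) ^ 1 \<le> 2 ^ n"
    using n by (intro power_increasing) auto
  then have h1: "h \<le> 1 / 16"
    by (simp add: h field_simps)
  have disj: "disjoint_family_on ?A (Pow {..<n} \<times> I)"
    unfolding disjoint_family_on_def
  proof (intro ballI impI, rule ccontr)
    fix x y assume xy: "x \<in> Pow {..<n} \<times> I" "y \<in> Pow {..<n} \<times> I" "x \<noteq> y" "?A x \<inter> ?A y \<noteq> {}"
    obtain S i S' j where eq: "x = (S, i)" "y = (S', j)"
      by (metis surj_pair)
    from xy obtain z where z: "z \<in> center_set (slope n S) (offset n S) h (1 + real i * h\<^sup>2)"
      "z \<in> center_set (slope n S') (offset n S') h (1 + real j * h\<^sup>2)"
      unfolding eq by auto
    have S: "S \<subseteq> {..<n}" "S' \<subseteq> {..<n}"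
      using xy by (auto simp: eq)
    have "\<bar>slope n S - slope n S'\<bar> \<le> 4 * h"
      using h0 h1 by (intro center_set_disjoint_slope[OF _ _ _ _ _ _ _ _ _ _ _ _ z]
          slope_nonneg slope_le_1 offset_bounds S) auto
    \<comment> \<open>The choice of \<open>h\<close> enters here: distinct slopes are at least
      \<open>1 / 2 ^ n = 8 * h\<close> apart.\<close>
    moreover have "4 * h < 1 / 2 ^ n"
      by (simp add: h field_simps)
    ultimately have "S = S'"
      using slope_separated[OF S] by linarith
    then have "\<bar>real i - real j\<bar> * h\<^sup>2 < 1 * h\<^sup>2"
      using center_set_disjoint_radius[of z _ _ h "1 + real i * h\<^sup>2" "1 + real j * h\<^sup>2"] z
      by (simp add: abs_mult flip: left_diff_distrib)
    then have "\<bar>real i - real j\<bar> < 1"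
      using h0 by (simp only: mult_less_cancel_right_pos zero_less_power)
    then have "i = j"
      by linarith
    then show False
      using xy \<open>S = S'\<close> eq by simp
  qed
  have fin: "finite (Pow {..<n} \<times> I)"
    using I by simp
  have sets: "?A x \<in> sets borel" for x
    by (cases x) simp
  then show "centers n h I \<in> sets borel"
    unfolding centers_def using fin by (intro sets.finite_UN) auto
  have "real (card I) * h\<^sup>2 / 32 = real (card (Pow {..<n} \<times> I)) * (h ^ 3 / 4)"
    using h0 by (simp add: card_cartesian_product card_Pow power2_eq_square power3_eq_cube) (simp add: h field_simps)
  also have "ennreal \<dots> = (\<Sum>x\<in>Pow {..<n} \<times> I. ennreal (h ^ 3 / 4))"
    using h0 by (subst sum_ennreal) auto
  also have "\<dots> \<le> (\<Sum>x\<in>Pow {..<n} \<times> I. emeasure lborel (?A x))"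
    using emeasure_center_set_ge[OF h0] by (intro sum_mono) (auto split: prod.split)
  also have "\<dots> = emeasure lborel (centers n h I)"
    unfolding centers_def using fin disj sets by (intro sum_emeasure) auto
  finally show "ennreal (real (card I) * h\<^sup>2 / 32) \<le> emeasure lborel (centers n h I)" .
qed

section \<open>Dilation and the grid of radii\<close>

lemma emeasure_dilation:
  fixes A :: "(real^2) set"
  assumes A: "A \<in> sets borel" and R: "0 < R"
  shows "{z. (1 / R) *\<^sub>R z \<in> A} \<in> sets borel"
    and "emeasure lborel {z. (1 / R) *\<^sub>R z \<in> A} = ennreal (R\<^sup>2) * emeasure lborel A"
proof -
  have "(\<lambda>z. (1 / R) *\<^sub>R z) \<in> borel_measurable (borel :: (real^2) measure)"
    by measurable
  from measurable_sets[OF this A] show S: "{z. (1 / R) *\<^sub>R z \<in> A} \<in> sets borel"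
    by (simp add: vimage_def)
  have eq: "lborel = density (distr lborel borel (\<lambda>x. 0 + R *\<^sub>R x :: real^2)) (\<lambda>_. ennreal (\<bar>R\<bar> ^ DIM(real^2)))"
    using R by (intro lborel_affine) auto
  have "emeasure lborel {z. (1 / R) *\<^sub>R z \<in> A} =
     emeasure (density (distr lborel borel (\<lambda>x. 0 + R *\<^sub>R x :: real^2)) (\<lambda>_. ennreal (\<bar>R\<bar> ^ DIM(real^2)))) {z. (1 / R) *\<^sub>R z \<in> A}"
    by (subst eq) simp
  also have "\<dots> = ennreal (R\<^sup>2) * emeasure (distr lborel borel (\<lambda>x. 0 + R *\<^sub>R x :: real^2)) {z. (1 / R) *\<^sub>R z \<in> A}"
    using S R by (subst emeasure_density_const) auto
  also have "\<dots> = ennreal (R\<^sup>2) * emeasure lborel A"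
    using S R by (subst emeasure_distr) (auto simp: vimage_def)
  finally show "emeasure lborel {z. (1 / R) *\<^sub>R z \<in> A} = ennreal (R\<^sup>2) * emeasure lborel A" .
qed

text \<open>Occupied grid cells stand in for a minimal cover: their number bounds the covering
  number from above, and each contains an actual radius, as the lower bound for the maximal function
  requires.\<close>

definition grid_index :: "real \<Rightarrow> real \<Rightarrow> real \<Rightarrow> nat" where
  "grid_index R d t = nat \<lfloor>(t / R - 1) / d\<rfloor>"

lemma grid_index_bounds:
  assumes "0 < R" "0 < d" "R \<le> t"
  shows "1 + real (grid_index R d t) * d \<le> t / R" "t / R < 1 + real (grid_index R d t) * d + d"
proof -
  have "0 \<le> (t / R - 1) / d"
    using assms by simp
  then have "real (grid_index R d t) \<le> (t / R - 1) / d" "(t / R - 1) / d < real (grid_index R d t) + 1"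
    by (simp_all add: grid_index_def)
  then show "1 + real (grid_index R d t) * d \<le> t / R" "t / R < 1 + real (grid_index R d t) * d + d"
    using assms(2) by (simp_all add: pos_le_divide_eq pos_divide_less_eq algebra_simps)
qed

lemma finite_grid_index:
  assumes "0 < R" "0 < d" "T \<subseteq> {R..<2 * R}"
  shows "finite (grid_index R d ` T)"
proof (rule finite_subset)
  show "grid_index R d ` T \<subseteq> {..nat \<lfloor>1 / d\<rfloor>}"
  proof
    fix i assume "i \<in> grid_index R d ` T"
    then obtain t where t: "t \<in> T" "i = grid_index R d t"
      by auto
    then have "R \<le> t" "t < 2 * R"
      using assms by auto
    then have "(t / R - 1) / d \<le> 1 / d"
      using assms by (intro divide_right_mono) (auto simp: field_simps)
    then show "i \<in> {..nat \<lfloor>1 / d\<rfloor>}"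
      unfolding t grid_index_def by (auto intro!: nat_mono floor_mono)
  qed
qed simp

lemma covering_number_le_grid:
  assumes "0 < R" "0 < d" "T \<subseteq> {R..<2 * R}" "T \<noteq> {}" "d \<le> \<delta>"
  shows "covering_number T (R * \<delta>) \<le> enat (card (grid_index R d ` T))"
proof -
  define C where "C = (\<lambda>i. R * (1 + real i * d)) ` grid_index R d ` T"
  have fin: "finite (grid_index R d ` T)"
    by (rule finite_grid_index[OF assms(1-3)])
  have "T \<subseteq> (\<Union>c\<in>C. {c..c + R * \<delta>})"
  proof
    fix t assume t: "t \<in> T"
    then have "R \<le> t"
      using assms by auto
    from grid_index_bounds[OF assms(1,2) this]
    have "R * (1 + real (grid_index R d t) * d) \<le> t" "t \<le> R * (1 + real (grid_index R d t) * d) + R * d"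
      using assms(1) by (simp_all add: field_simps)
    moreover have "R * d \<le> R * \<delta>"
      using assms by (intro mult_left_mono) auto
    ultimately show "t \<in> (\<Union>c\<in>C. {c..c + R * \<delta>})"
      using t by (intro UN_I[of "R * (1 + real (grid_index R d t) * d)"]) (auto simp: C_def)
  qed
  then have "covering_number T (R * \<delta>) \<le> enat (card C)"
    unfolding covering_number_def if_not_P[OF assms(4)]
    by (intro INF_lower CollectI conjI) (simp_all add: C_def fin)
  also have "\<dots> \<le> enat (card (grid_index R d ` T))"
    unfolding C_def using card_image_le[OF fin] by simp
  finally show ?thesis .
qed

text \<open>Some \<open>t\<close> in \<open>T\<close> lies in the cell attached to the centre, so
  \<open>t / R\<close> exceeds the grid radius by less than \<open>h^2\<close>. An arc of angle
  \<open>h / 4\<close> then falls into one tube, and its share of the circle is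
  \<open>h / (8 * pi)\<close>.\<close>

lemma maximal_fn_indicator_ge:
  assumes h: "h = 1 / (8 * 2 ^ n)" and n: "0 < n" and R: "0 < R"
    and T: "T \<subseteq> {R..<2 * R}" "T \<subseteq> E"
    and z: "(1 / R) *\<^sub>R z \<in> centers n h (grid_index R (h\<^sup>2) ` T)"
  shows "ennreal (h / (8 * pi)) \<le> maximal_fn E (indicator {w. (1 / R) *\<^sub>R w \<in> kakeya_set n h (4 * h\<^sup>2)}) z"
proof -
  let ?F = "{w. (1 / R) *\<^sub>R w \<in> kakeya_set n h (4 * h\<^sup>2)}"
  have h0: "0 < h" 
    by (simp add: h)
  have "(2::real) ^ 1 \<le> 2 ^ n"
    using n by (intro power_increasing) auto
  then have h1: "h \<le> 1 / 16"
    by (simp add: h field_simps)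
  from z obtain S t where S: "S \<subseteq> {..<n}" and t: "t \<in> T"
    and z': "(1 / R) *\<^sub>R z \<in> center_set (slope n S) (offset n S) h (1 + real (grid_index R (h\<^sup>2) t) * h\<^sup>2)"
    unfolding centers_def by auto
  have tR: "R \<le> t" "t < 2 * R"
    using t T by auto
  have tb: "1 + real (grid_index R (h\<^sup>2) t) * h\<^sup>2 \<le> t / R" "t / R < 1 + real (grid_index R (h\<^sup>2) t) * h\<^sup>2 + h\<^sup>2"
    "0 < t / R" "t / R < 2"
    using grid_index_bounds[of R "h\<^sup>2" t] h0 R tR by (simp_all add: field_simps)
  define \<theta> where "\<theta> = pi / 2 + arctan (slope n S)"
  have \<theta>: "0 \<le> \<theta>" "\<theta> + h / 4 < 2 * pi"
    using arctan_lbound[of "slope n S"] arctan_ubound[of "slope n S"] h1 pi_gt3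
    by (simp_all add: \<theta>_def)
  have "(\<theta> + h / 4 - \<theta>) / (2 * pi) \<le> cmod (circular_mean t (indicator ?F) z)"
  proof (rule circular_mean_indicator_ge)
    show "?F \<in> sets borel"
      using R by (intro emeasure_dilation) auto
    fix \<psi> assume \<psi>: "\<theta> \<le> \<psi>" "\<psi> \<le> \<theta> + h / 4"
    have "(1 / R) *\<^sub>R z - (t / R) *\<^sub>R vector [cos \<psi>, sin \<psi>]
      \<in> parallelogram (slope n S) 0 h (h * offset n S) (h * offset n S + 4 * h\<^sup>2)"
      by (rule arc_in_tube[OF slope_nonneg slope_le_1[OF S] h0 h1 tb z', of "\<psi> - \<theta>"])
        (use \<psi> in \<open>auto simp: \<theta>_def\<close>)
    then have "(1 / R) *\<^sub>R z - (t / R) *\<^sub>R vector [cos \<psi>, sin \<psi>] \<in> kakeya_set n h (4 * h\<^sup>2)"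
      unfolding kakeya_set_def using S by auto
    then show "z - t *\<^sub>R vector [cos \<psi>, sin \<psi>] \<in> ?F"
      by (simp add: scaleR_diff_right)
  qed (use \<theta> h0 in auto)
  then have "ennreal (h / (8 * pi)) \<le> ennreal (cmod (circular_mean t (indicator ?F) z))"
    by (intro ennreal_leI) simp
  also have "\<dots> \<le> maximal_fn E (indicator ?F) z"
    unfolding maximal_fn_def using t T by (intro SUP_upper) auto
  finally show ?thesis .
qed

text \<open>The weak type inequality is tested on the indicator of the dilated Kakeya set
  \<open>F\<close>, of area at most \<open>5 * R^2 * h^2 / n\<close>; the maximal function is at
  least \<open>h / (8 * pi)\<close> on the dilated set of centres \<open>G\<close>. After squaring,
  \<open>R\<close> cancels.\<close>

lemma card_grid_le:
  assumes C: "0 \<le> C"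
    and weak: "\<And>f. f \<in> lorentz_space_1 2 \<Longrightarrow> lorentz_inf 2 lborel (maximal_fn E f)
       \<le> ennreal C * lorentz_1 2 lborel (\<lambda>x. ennreal (cmod (f x)))"
    and h: "h = 1 / (8 * 2 ^ n)" and n: "0 < n" and R: "0 < R"
    and T: "T \<subseteq> {R..<2 * R}" "T \<subseteq> E" "T \<noteq> {}"
  shows "real (card (grid_index R (h\<^sup>2) ` T)) * n * h\<^sup>2 \<le> 81920 * pi\<^sup>2 * C\<^sup>2"
proof -
  define I where "I = grid_index R (h\<^sup>2) ` T"
  have h0: "0 < h" 
    by (simp add: h)
  have I: "finite I" "0 < card I"
    unfolding I_def using finite_grid_index[OF R _ T(1)] h0 T(3) by (auto simp: card_gt_0_iff)
  define F where "F = {z. (1 / R) *\<^sub>R z \<in> kakeya_set n h (4 * h\<^sup>2)}"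
  define G where "G = {z. (1 / R) *\<^sub>R z \<in> centers n h I}"
  note cen = emeasure_centers_ge[OF h n I(1)]
  have F: "F \<in> sets borel"
    unfolding F_def using R by (intro emeasure_dilation) auto
  have G: "G \<in> sets borel"
    unfolding G_def using R cen by (intro emeasure_dilation) auto
  have "emeasure lborel F = ennreal (R\<^sup>2) * emeasure lborel (kakeya_set n h (4 * h\<^sup>2))"
    unfolding F_def using R by (intro emeasure_dilation) auto
  also have "\<dots> \<le> ennreal (R\<^sup>2) * ennreal (4 * h\<^sup>2 / n + h * (4 * h\<^sup>2) * 2 ^ n / n)"
    using h0 n by (intro mult_left_mono emeasure_kakeya_set_le) auto
  \<comment> \<open>With \<open>h * 2 ^ n = 1 / 8\<close> the second summand is an eighth of the
    first.\<close>
  also have "4 * h\<^sup>2 / n + h * (4 * h\<^sup>2) * 2 ^ n / n = 9 / 2 * h\<^sup>2 / n"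
  proof -
    have "h * 2 ^ n = 1 / 8"
      by (simp add: h)
    moreover have "h * (4 * h\<^sup>2) * 2 ^ n = (h * 2 ^ n) * (4 * h\<^sup>2)"
      by (simp only: ac_simps)
    ultimately have "h * (4 * h\<^sup>2) * 2 ^ n = h\<^sup>2 / 2"
      by simp
    then show ?thesis
      by (simp only: flip: add_divide_distrib) simp
  qed
  also have "ennreal (R\<^sup>2) * ennreal (9 / 2 * h\<^sup>2 / n) \<le> ennreal (R\<^sup>2 * (5 * h\<^sup>2 / n))"
  proof -
    have "9 / 2 * h\<^sup>2 / n \<le> 5 * h\<^sup>2 / n"
      by (intro divide_right_mono) auto
    then have "R\<^sup>2 * (9 / 2 * h\<^sup>2 / n) \<le> R\<^sup>2 * (5 * h\<^sup>2 / n)"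
      by (intro mult_left_mono) auto
    then show ?thesis
      by (subst ennreal_mult[symmetric]) (auto intro: ennreal_leI)
  qed
  finally have Fle: "emeasure lborel F \<le> ennreal (R\<^sup>2 * (5 * h\<^sup>2 / n))" .
  have norm: "lorentz_1 2 lborel (\<lambda>x. ennreal (cmod (indicator F x))) \<le> ennreal (2 * sqrt (R\<^sup>2 * (5 * h\<^sup>2 / n)))"
    by (intro lorentz_1_indicator_le F Fle) auto
  then have "indicator F \<in> lorentz_space_1 2"
    unfolding lorentz_space_1_def using F by (auto simp: less_top[symmetric] top_unique)
  from weak[OF this] 
  have upper: "lorentz_inf 2 lborel (maximal_fn E (indicator F)) \<le> ennreal (C * (2 * sqrt (R\<^sup>2 * (5 * h\<^sup>2 / n))))"
    using mult_left_mono[OF norm, of "ennreal C"] C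
    by (simp add: ennreal_mult)
  \<comment> \<open>Half the lower bound for the area of \<open>G\<close>, which makes the
    comparison with that area strict.\<close>
  define m where "m = R\<^sup>2 * (real (card I) * h\<^sup>2 / 64)"
  have m: "0 < m"
    using R I h0 by (simp add: m_def)
  have "ennreal m < ennreal (R\<^sup>2 * (real (card I) * h\<^sup>2 / 32))"
    using R I h0 by (intro ennreal_lessI) (auto simp: m_def)
  also have "\<dots> = ennreal (R\<^sup>2) * ennreal (real (card I) * h\<^sup>2 / 32)"
    by (intro ennreal_mult) auto
  also have "\<dots> \<le> ennreal (R\<^sup>2) * emeasure lborel (centers n h I)"
    by (intro mult_left_mono cen) auto
  also have "\<dots> = emeasure lborel G"
    unfolding G_def by (rule emeasure_dilation(2)[OF cen(2) R, symmetric])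
  finally have Gm: "ennreal m < emeasure lborel G" .
  have "ennreal (sqrt m * (h / (8 * pi))) = ennreal (sqrt m) * ennreal (h / (8 * pi))"
    using m h0 by (intro ennreal_mult) auto
  also have "\<dots> \<le> lorentz_inf 2 lborel (maximal_fn E (indicator F))"
    using maximal_fn_indicator_ge[OF h n R T(1,2)]
    by (intro lorentz_inf_ge[OF G m Gm]) (simp add: G_def F_def I_def)
  also note upper
  finally have "sqrt m * (h / (8 * pi)) \<le> C * (2 * sqrt (R\<^sup>2 * (5 * h\<^sup>2 / n)))"
    using C by (subst (asm) ennreal_le_iff) auto
  then have "(sqrt m * (h / (8 * pi)))\<^sup>2 \<le> (C * (2 * sqrt (R\<^sup>2 * (5 * h\<^sup>2 / n))))\<^sup>2"
    using m h0 by (intro power_mono) auto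
  then have "m * (h / (8 * pi))\<^sup>2 \<le> C\<^sup>2 * (4 * (R\<^sup>2 * (5 * h\<^sup>2 / n)))"
    unfolding power_mult_distrib using m real_sqrt_pow2[of "R\<^sup>2 * (5 * h\<^sup>2 / n)"] by simp
  \<comment> \<open>\<open>81920 = 64 * 64 * 20\<close>: the divisor in \<open>m\<close>, the square
    of 8 from \<open>8 * pi\<close>, and \<open>4 * 5\<close> on the right.\<close>
  then have "(R\<^sup>2 * h\<^sup>2) * (real (card I) * n * h\<^sup>2) \<le> (R\<^sup>2 * h\<^sup>2) * (81920 * pi\<^sup>2 * C\<^sup>2)"
    using n by (simp add: m_def power_divide power_mult_distrib field_simps)
  then show ?thesis
    using R h0 by (simp add: I_def)
qed

section \<open>From the grid count to covering numbers\<close>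

lemma dyadic_scale:
  assumes "0 < \<delta>" "\<delta> < (1::real)"
  obtains n :: nat where "0 < n" "1 / 4 ^ n \<le> \<delta>" "\<delta> \<le> 4 / 4 ^ n" "ln (1 / \<delta>) \<le> 2 * real n"
proof -
  have ex: "\<exists>n. 1 / 4 ^ n \<le> \<delta>"
    using real_arch_pow_inv[OF assms(1), of "1 / 4"] by (auto simp: power_divide intro: less_imp_le)
  \<comment> \<open>Minimality gives the upper bound for \<open>\<delta>\<close>, since
    \<open>n - 1\<close> fails; \<open>n\<close> is positive because
    \<open>\<delta> < 1\<close>.\<close>
  define n where "n = (LEAST n. 1 / 4 ^ n \<le> \<delta>)"
  have n: "1 / 4 ^ n \<le> \<delta>"
    unfolding n_def using ex by (rule LeastI_ex)
  have n0: "0 < n"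
    using n assms by (cases n) auto
  have "\<not> 1 / 4 ^ (n - 1) \<le> \<delta>"
    using n0 not_less_Least[of "n - 1" "\<lambda>n. 1 / 4 ^ n \<le> \<delta>"] by (simp add: n_def)
  then have "\<delta> \<le> 4 / 4 ^ n"
    using n0 by (cases n) (auto simp: field_simps)
  moreover have "ln (1 / \<delta>) \<le> 2 * real n"
  proof -
    have "1 / \<delta> \<le> 4 ^ n"
      using n assms by (simp add: field_simps)
    then have "ln (1 / \<delta>) \<le> ln (4 ^ n)"
      using assms by (subst ln_le_cancel_iff) auto
    also have "\<dots> = real n * ln (2 ^ 2)"
      by (simp add: ln_realpow)
    also have "\<dots> = real n * (2 * ln 2)"
      by (subst ln_realpow) auto
    also have "\<dots> \<le> real n * (2 * 1)"
      using ln_2_less_1 by (intro mult_left_mono) auto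
    finally show ?thesis by simp
  qed
  ultimately show ?thesis
    using that n n0 by blast
qed

text \<open>With \<open>h^2 = 1 / 4 ^ n / 64\<close> one has
  \<open>h^2 \<le> \<delta> \<le> 256 * h^2\<close> and
  \<open>ln (1 / \<delta>) \<le> 2 * n\<close>, whence the factor 512. The summand 1 handles an
  empty block, whose covering number is 1 by convention.\<close>

lemma covering_number_bound:
  assumes C: "0 \<le> C"
    and weak: "\<And>f. f \<in> lorentz_space_1 2 \<Longrightarrow> lorentz_inf 2 lborel (maximal_fn E f)
       \<le> ennreal C * lorentz_1 2 lborel (\<lambda>x. ennreal (cmod (f x)))"
    and \<delta>: "0 < \<delta>" "\<delta> < 1"
  shows "ennreal_of_enat (covering_number (dyadic_part E k) (2 ^ k * \<delta>)) * ennreal (\<delta> * ln (1 / \<delta>))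
    \<le> ennreal (1 + 512 * (81920 * pi\<^sup>2 * C\<^sup>2))"
proof (cases "dyadic_part E k = {}")
  case True
  have "ln (1 / \<delta>) \<le> 1 / \<delta> - 1"
    using \<delta> by (intro ln_le_minus_one) auto
  then have "\<delta> * ln (1 / \<delta>) \<le> \<delta> * (1 / \<delta> - 1)"
    using \<delta> by (intro mult_left_mono) auto
  also have "\<dots> \<le> 1 + 512 * (81920 * pi\<^sup>2 * C\<^sup>2)"
    using \<delta> by (simp add: right_diff_distrib add_increasing2)
  finally show ?thesis
    using True by (simp add: covering_number_def ennreal_leI one_enat_def del: ennreal_plus)
next
  case False
  obtain n :: nat where n: "0 < n" "1 / 4 ^ n \<le> \<delta>" "\<delta> \<le> 4 / 4 ^ n" "ln (1 / \<delta>) \<le> 2 * real n"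
    using dyadic_scale[OF \<delta>] by blast
  define h :: real where "h = 1 / (8 * 2 ^ n)"
  have h2: "h\<^sup>2 = 1 / 4 ^ n / 64"
    by (simp add: h_def power_divide power_mult_distrib power2_eq_square flip: power_mult_distrib)
  have h0: "0 < h\<^sup>2"
    by (simp add: h_def)
  have "h\<^sup>2 \<le> \<delta>"
    using n(2) \<delta> h2 by simp
  have T: "dyadic_part E k \<subseteq> {2 ^ k..<2 * 2 ^ k}" "dyadic_part E k \<subseteq> E"
    by (auto simp: dyadic_part_def)
  define N where "N = card (grid_index (2 ^ k) (h\<^sup>2) ` dyadic_part E k)"
  have "covering_number (dyadic_part E k) (2 ^ k * \<delta>) \<le> enat N"
    unfolding N_def by (intro covering_number_le_grid T False h0 \<open>h\<^sup>2 \<le> \<delta>\<close>) auto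
  then have "ennreal_of_enat (covering_number (dyadic_part E k) (2 ^ k * \<delta>)) \<le> ennreal (real N)"
    by (metis ennreal_of_enat_enat ennreal_of_enat_le_iff ennreal_of_nat_eq_real_of_nat)
  then have "ennreal_of_enat (covering_number (dyadic_part E k) (2 ^ k * \<delta>)) * ennreal (\<delta> * ln (1 / \<delta>))
    \<le> ennreal (real N) * ennreal (\<delta> * ln (1 / \<delta>))"
    by (intro mult_right_mono) auto
  also have "\<dots> = ennreal (real N * (\<delta> * ln (1 / \<delta>)))"
    using \<delta> by (intro ennreal_mult[symmetric]) auto
  also have "\<dots> \<le> ennreal (1 + 512 * (81920 * pi\<^sup>2 * C\<^sup>2))"
  proof (rule ennreal_leI)
    have "\<delta> * ln (1 / \<delta>) \<le> (256 * h\<^sup>2) * (2 * real n)"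
      using n \<delta> h2 by (intro mult_mono) auto
    then have "real N * (\<delta> * ln (1 / \<delta>)) \<le> real N * ((256 * h\<^sup>2) * (2 * real n))"
      by (intro mult_left_mono) auto
    also have "\<dots> = 512 * (real N * n * h\<^sup>2)"
      by simp
    also have "\<dots> \<le> 512 * (81920 * pi\<^sup>2 * C\<^sup>2)"
      unfolding N_def by (intro mult_left_mono card_grid_le[OF C weak h_def n(1) _ T False]) auto
    finally show "real N * (\<delta> * ln (1 / \<delta>)) \<le> 1 + 512 * (81920 * pi\<^sup>2 * C\<^sup>2)"
      by simp
  qed
  finally show ?thesis .
qed

theorem proposition1p5:
  fixes E :: "real set"
  assumes "E \<subseteq> {0<..}"
    and "(SUP k\<in>{0<..}. SUP \<delta>\<in>{0<..<1/10}.
            ennreal_of_enat (covering_number (dyadic_part E k) (2 ^ k * \<delta>)) * ennreal (\<delta> * ln (1 / \<delta>))) = \<infinity>"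
  shows "\<not> restricted_weak_type 2 2 (maximal_fn E)"
proof
  assume "restricted_weak_type 2 2 (maximal_fn E)"
  then obtain C0 where C0: "\<forall>f\<in>lorentz_space_1 2. lorentz_inf 2 lborel (maximal_fn E f)
       \<le> ennreal C0 * lorentz_1 2 lborel (\<lambda>x. ennreal (cmod (f x)))"
    unfolding restricted_weak_type_def by blast
  \<comment> \<open>\<open>ennreal\<close> sends negative reals to 0, so the constant may be taken
    nonnegative.\<close>
  define C where "C = max C0 0"
  have "ennreal C0 = ennreal C"
    by (auto simp: C_def max_def ennreal_neg)
  then have weak: "\<And>f. f \<in> lorentz_space_1 2 \<Longrightarrow> lorentz_inf 2 lborel (maximal_fn E f)
       \<le> ennreal C * lorentz_1 2 lborel (\<lambda>x. ennreal (cmod (f x)))"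
    using C0 by simp
  have "(SUP k\<in>{0<..}. SUP \<delta>\<in>{0<..<1/10}.
            ennreal_of_enat (covering_number (dyadic_part E k) (2 ^ k * \<delta>)) * ennreal (\<delta> * ln (1 / \<delta>)))
     \<le> ennreal (1 + 512 * (81920 * pi\<^sup>2 * C\<^sup>2))"
    by (intro SUP_least covering_number_bound weak) (auto simp: C_def)
  then show False
    using assms(2) by (simp add: top_unique)
qed

end
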